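(* For every pair $(m,n)$ of positive integers, there exists an atomic monoid $M$ with $|\mathcal{L}(M)| = m$ and $|\mathcal{S}(M)| = n$.
   Context: Throughout, "monoid" means cancellative commutative monoid; a monoid $M$ is written additively with identity $0$, and $\mathcal{U}(M)$ denotes its group of invertible elements (units). An element $a \in M \setminus \mathcal{U}(M)$ is an atom if $a = x+y$ with $x,y \in M$ implies that $x$ or $y$ is a unit; $\mathcal{A}(M)$ is the set of atoms. For $x,y\in M$, $y$ divides $x$ if $x=y+z$ for some $z\in M$. An element $p \in M\setminus\mathcal{U}(M)$ is prime if whenever $p$ divides $x+y$ with $x,y \in M$, $p$ divides $x$ or $p$ divides $y$. $M$ is atomic if every non-unit element of $M$ is a (finite) sum of atoms. Let $M_{\mathrm{red}} := M/\mathcal{U}(M)$. For an atomic monoid $M$, let $\mathsf{Z}(M)$ be the free commutative monoid of formal sums of elements of $\mathcal{A}(M_{\mathrm{red}})$, and let $\pi \colon \mathsf{Z}(M) \to M_{\mathrm{red}}$ be the unique monoid homomorphism with $\pi(a) = a$ for every $a \in \mathcal{A}(M_{\mathrm{red}})$. The length $|z|$ of $z = a_1 + \cdots + a_\ell \in \mathsf{Z}(M)$ is $\ell$. A factorization relation of $M$ is a pair $(z_1,z_2)\in \mathsf{Z}(M)^2$ with $\pi(z_1)=\pi(z_2)$; it is irredundant if no atom appears in both $z_1$ and $z_2$. An atom $a$ is purely long (resp., purely short) if it is not prime and for every irredundant factorization relation $(z_1,z_2)$ such that $a$ (identified with its class in $M_{\mathrm{red}}$) appears in $z_1$, one has $|z_1|>|z_2|$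 (resp., $|z_1|<|z_2|$). $\mathcal{L}(M)$ (resp., $\mathcal{S}(M)$) denotes the set of purely long (resp., purely short) atoms of $M_{\mathrm{red}}$. *)

theory Defs
  imports "HOL-Algebra.Divisibility" "HOL-Algebra.FiniteProduct" "HOL-Library.Multiset"
begin

text \<open>
  Monoids are the cancellative commutative monoids of HOL-Algebra
  (\<^locale>\<open>comm_monoid_cancel\<close>), hence written multiplicatively. Units, divisibility and primality
  are \<^const>\<open>Units\<close>, \<^const>\<open>factor\<close> and \<^const>\<open>prime\<close>.
\<close>

definition atoms :: "('a, 'b) monoid_scheme \<Rightarrow> 'a set" where
  "atoms M = {a \<in> carrier M - Units M.
     \<forall>x\<in>carrier M. \<forall>y\<in>carrier M. a = x \<otimes>\<^bsub>M\<^esub> y \<longrightarrow> x \<in> Units M \<or> y \<in> Units M}"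

definition atomic_monoid :: "('a, 'b) monoid_scheme \<Rightarrow> bool" where
  "atomic_monoid M \<longleftrightarrow> comm_monoid_cancel M \<and>
     (\<forall>x \<in> carrier M - Units M.
        \<exists>as. set as \<subseteq> atoms M \<and> x = foldr (\<otimes>\<^bsub>M\<^esub>) as \<one>\<^bsub>M\<^esub>)"

text \<open>
  The quotient by the group of units. Although \<^const>\<open>FactGroup\<close> is named for groups, its
  definition (cosets under set multiplication) makes sense for monoids, see
  \<open>comm_monoid_cancel_reduced\<close> below.
\<close>

definition reduced :: "('a, 'b) monoid_scheme \<Rightarrow> 'a set monoid" where
  "reduced M = M Mod Units M"

definition reduced_class :: "('a, 'b) monoid_scheme \<Rightarrow> 'a \<Rightarrow> 'a set" where
  "reduced_class M a = Units M #>\<^bsub>M\<^esub> a"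

text \<open>
  The free commutative monoid on the atoms of the reduced monoid consists of the finite multisets
  of such atoms under multiset union; the length of a factorization is its \<^const>\<open>size\<close>.
\<close>

definition factorizations :: "('a, 'b) monoid_scheme \<Rightarrow> 'a set multiset set" where
  "factorizations M = {z. set_mset z \<subseteq> atoms (reduced M)}"

text \<open>
  The factorization homomorphism, defined by its explicit formula; \<open>factorization_hom_unique\<close>
  below shows that it is the only homomorphism extending the inclusion of the atoms.
\<close>

definition factorization_hom :: "('a, 'b) monoid_scheme \<Rightarrow> 'a set multiset \<Rightarrow> 'a set" where
  "factorization_hom M z =
     (\<Otimes>\<^bsub>reduced M\<^esub>a\<in>set_mset z. a [^]\<^bsub>reduced M\<^esub> count z a)"

definition factorization_relation ::
    "('a, 'b) monoid_scheme \<Rightarrow> 'a set multiset \<Rightarrow> 'a set multiset \<Rightarrow> bool" where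
  "factorization_relation M z\<^sub>1 z\<^sub>2 \<longleftrightarrow> z\<^sub>1 \<in> factorizations M \<and> z\<^sub>2 \<in> factorizations M \<and>
     factorization_hom M z\<^sub>1 = factorization_hom M z\<^sub>2"

definition irredundant :: "'c multiset \<Rightarrow> 'c multiset \<Rightarrow> bool" where
  "irredundant z\<^sub>1 z\<^sub>2 \<longleftrightarrow> set_mset z\<^sub>1 \<inter> set_mset z\<^sub>2 = {}"

definition purely_long :: "('a, 'b) monoid_scheme \<Rightarrow> 'a \<Rightarrow> bool" where
  "purely_long M a \<longleftrightarrow> a \<in> atoms M \<and> \<not> prime M a \<and>
     (\<forall>z\<^sub>1 z\<^sub>2. factorization_relation M z\<^sub>1 z\<^sub>2 \<and> irredundant z\<^sub>1 z\<^sub>2 \<and> reduced_class M a \<in># z\<^sub>1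
        \<longrightarrow> size z\<^sub>1 > size z\<^sub>2)"

definition purely_short :: "('a, 'b) monoid_scheme \<Rightarrow> 'a \<Rightarrow> bool" where
  "purely_short M a \<longleftrightarrow> a \<in> atoms M \<and> \<not> prime M a \<and>
     (\<forall>z\<^sub>1 z\<^sub>2. factorization_relation M z\<^sub>1 z\<^sub>2 \<and> irredundant z\<^sub>1 z\<^sub>2 \<and> reduced_class M a \<in># z\<^sub>1
        \<longrightarrow> size z\<^sub>1 < size z\<^sub>2)"

text \<open>
  Purely long and purely short atoms are counted in the reduced monoid, that is, up to associates.
\<close>

definition purely_long_atoms :: "('a, 'b) monoid_scheme \<Rightarrow> 'a set set" where
  "purely_long_atoms M = reduced_class M ` {a. purely_long M a}"

definition purely_short_atoms :: "('a, 'b) monoid_scheme \<Rightarrow> 'a set set" where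
  "purely_short_atoms M = reduced_class M ` {a. purely_short M a}"


lemma carrier_reduced: "carrier (reduced M) = reduced_class M ` carrier M"
  by (auto simp: reduced_def reduced_class_def FactGroup_def RCOSETS_def)

context comm_monoid_cancel
begin

lemma one_reduced: "\<one>\<^bsub>reduced G\<^esub> = reduced_class G \<one>"
proof -
  have "(\<Union>u\<in>Units G. {u \<otimes> \<one>}) = (\<Union>u\<in>Units G. {u})"
    by (intro SUP_cong) (simp_all add: Units_closed)
  then show ?thesis
    by (simp add: reduced_def reduced_class_def FactGroup_def r_coset_def)
qed

lemma mult_reduced:
  assumes "a \<in> carrier G" "b \<in> carrier G"
  shows "reduced_class G a \<otimes>\<^bsub>reduced G\<^esub> reduced_class G b = reduced_class G (a \<otimes> b)"
proof -
  have "(u \<otimes> a) \<otimes> (v \<otimes> b) = (u \<otimes> v) \<otimes> (a \<otimes> b)" if "u \<in> Units G" "v \<in> Units G" for u v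
    using that assms by (simp add: Units_closed m_ac)
  moreover have "u \<otimes> (a \<otimes> b) = (u \<otimes> a) \<otimes> (\<one> \<otimes> b)" if "u \<in> Units G" for u
    using that assms by (simp add: Units_closed m_ac)
  ultimately have "(\<Union>u\<in>Units G. \<Union>v\<in>Units G. {u \<otimes> a \<otimes> (v \<otimes> b)})
      = (\<Union>u\<in>Units G. {u \<otimes> (a \<otimes> b)})"
    by (intro equalityI subsetI) (blast intro: Units_m_closed Units_one_closed)+
  then show ?thesis
    by (simp add: reduced_def reduced_class_def FactGroup_def r_coset_def set_mult_def)
qed

lemma reduced_class_eq_iff:
  assumes "a \<in> carrier G" "b \<in> carrier G"
  shows "reduced_class G a = reduced_class G b \<longleftrightarrow> (\<exists>u\<in>Units G. a = u \<otimes> b)"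
proof
  assume "reduced_class G a = reduced_class G b"
  moreover have "a \<in> reduced_class G a"
    using assms by (auto simp: reduced_class_def r_coset_def intro!: bexI[of _ "\<one>"])
  ultimately show "\<exists>u\<in>Units G. a = u \<otimes> b"
    by (auto simp: reduced_class_def r_coset_def)
next
  assume "\<exists>u\<in>Units G. a = u \<otimes> b"
  then obtain u where u: "u \<in> Units G" "a = u \<otimes> b" by blast
  have "v \<otimes> a \<in> reduced_class G b" if v: "v \<in> Units G" for v
  proof -
    have "v \<otimes> a = (v \<otimes> u) \<otimes> b"
      using v u assms by (simp add: Units_closed m_assoc)
    then show ?thesis
      using Units_m_closed[OF v u(1)] unfolding reduced_class_def r_coset_def by auto
  qed
  moreover have "v \<otimes> b \<in> reduced_class G a" if v: "v \<in> Units G" for v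
  proof -
    have "(v \<otimes> inv u) \<otimes> (u \<otimes> b) = v \<otimes> ((inv u \<otimes> u) \<otimes> b)"
      using v u assms(2) by (simp add: Units_closed m_assoc del: Units_l_inv)
    then have "v \<otimes> b = (v \<otimes> inv u) \<otimes> a"
      using v u assms(2) by simp
    then show ?thesis
      using Units_m_closed[OF v Units_inv_Units[OF u(1)]]
      unfolding reduced_class_def r_coset_def by auto
  qed
  ultimately show "reduced_class G a = reduced_class G b"
    unfolding reduced_class_def r_coset_def by auto
qed

lemma comm_monoid_cancel_reduced: "comm_monoid_cancel (reduced G)"
proof (rule comm_monoid_cancelI)
  show "comm_monoid (reduced G)"
    by (rule comm_monoidI) (auto simp: carrier_reduced mult_reduced one_reduced m_ac)
next
  fix a b c
  assume eq: "a \<otimes>\<^bsub>reduced G\<^esub> c = b \<otimes>\<^bsub>reduced G\<^esub> c"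
    and car: "a \<in> carrier (reduced G)" "b \<in> carrier (reduced G)" "c \<in> carrier (reduced G)"
  from car obtain a' b' c' where x: "a' \<in> carrier G" "b' \<in> carrier G" "c' \<in> carrier G"
    "a = reduced_class G a'" "b = reduced_class G b'" "c = reduced_class G c'"
    by (auto simp: carrier_reduced)
  with eq obtain u where u: "u \<in> Units G" "a' \<otimes> c' = u \<otimes> (b' \<otimes> c')"
    by (auto simp: mult_reduced reduced_class_eq_iff)
  then have "a' \<otimes> c' = (u \<otimes> b') \<otimes> c'"
    using x by (simp add: Units_closed m_assoc)
  then have "a' = u \<otimes> b'"
    using x u by (blast intro: r_cancel m_closed)
  with x u show "a = b"
    by (auto simp: reduced_class_eq_iff)
qed

lemma factorization_hom_empty: "factorization_hom G {#} = \<one>\<^bsub>reduced G\<^esub>"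
proof -
  interpret R: comm_monoid_cancel "reduced G" by (rule comm_monoid_cancel_reduced)
  show ?thesis by (simp add: factorization_hom_def)
qed

lemma atoms_reduced_closed: "a \<in> atoms (reduced G) \<Longrightarrow> a \<in> carrier (reduced G)"
  by (simp add: atoms_def)

lemma factorization_hom_union:
  assumes "z \<in> factorizations G" "w \<in> factorizations G"
  shows "factorization_hom G (z + w) = factorization_hom G z \<otimes>\<^bsub>reduced G\<^esub> factorization_hom G w"
proof -
  interpret R: comm_monoid_cancel "reduced G" by (rule comm_monoid_cancel_reduced)
  let ?A = "set_mset z \<union> set_mset w"
  have A: "a \<in> carrier (reduced G)" if "a \<in> ?A" for a
    using that assms by (auto simp: factorizations_def dest: atoms_reduced_closed)
  have ext: "factorization_hom G v = (\<Otimes>\<^bsub>reduced G\<^esub>a\<in>?A. a [^]\<^bsub>reduced G\<^esub> count v a)"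
    if "set_mset v \<subseteq> ?A" for v
    unfolding factorization_hom_def
    by (rule R.finprod_mono_neutral_cong_left)
      (use that A in \<open>auto simp: not_in_iff intro!: R.nat_pow_closed\<close>)
  have "factorization_hom G (z + w) = (\<Otimes>\<^bsub>reduced G\<^esub>a\<in>?A.
      a [^]\<^bsub>reduced G\<^esub> count z a \<otimes>\<^bsub>reduced G\<^esub> a [^]\<^bsub>reduced G\<^esub> count w a)"
    unfolding factorization_hom_def set_mset_union
    by (rule R.finprod_cong') (use A in \<open>auto simp: R.nat_pow_mult\<close>)
  also have "\<dots> = (\<Otimes>\<^bsub>reduced G\<^esub>a\<in>?A. a [^]\<^bsub>reduced G\<^esub> count z a)
      \<otimes>\<^bsub>reduced G\<^esub> (\<Otimes>\<^bsub>reduced G\<^esub>a\<in>?A. a [^]\<^bsub>reduced G\<^esub> count w a)"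
    by (rule R.finprod_multf) (use A in auto)
  also have "\<dots> = factorization_hom G z \<otimes>\<^bsub>reduced G\<^esub> factorization_hom G w"
    by (simp add: ext)
  finally show ?thesis .
qed

lemma factorization_hom_single:
  assumes "a \<in> atoms (reduced G)"
  shows "factorization_hom G {#a#} = a"
proof -
  interpret R: comm_monoid_cancel "reduced G" by (rule comm_monoid_cancel_reduced)
  show ?thesis
    using atoms_reduced_closed[OF assms] by (simp add: factorization_hom_def)
qed

lemma factorization_hom_unique:
  assumes "h {#} = \<one>\<^bsub>reduced G\<^esub>"
    and "\<And>z w. z \<in> factorizations G \<Longrightarrow> w \<in> factorizations G
           \<Longrightarrow> h (z + w) = h z \<otimes>\<^bsub>reduced G\<^esub> h w"
    and "\<And>a. a \<in> atoms (reduced G) \<Longrightarrow> h {#a#} = a"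
    and "z \<in> factorizations G"
  shows "h z = factorization_hom G z"
  using assms(4)
proof (induction z)
  case empty
  show ?case by (simp add: assms(1) factorization_hom_empty)
next
  case (add a z)
  then have "a \<in> atoms (reduced G)" "{#a#} \<in> factorizations G" "z \<in> factorizations G"
    by (auto simp: factorizations_def)
  then show ?case
    using add.IH assms(2)[of "{#a#}" z] assms(3)[of a] factorization_hom_union[of "{#a#}" z]
      factorization_hom_single[of a] by simp
qed

end

end

theory Submission
  imports Defs
begin

text \<open>
  Let \<open>M\<close> be generated by \<open>b\<^sub>1, \<dots>, b\<^sub>n, a\<^sub>1, \<dots>, a\<^sub>m\<close> subject to the single relation
  \<open>2(b\<^sub>1 + \<dots> + b\<^sub>n) = (2n + 1)(a\<^sub>1 + \<dots> + a\<^sub>m)\<close>. As 2 and \<open>2n + 1\<close> are coprime, the two sides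
  of any factorization relation differ by an integer multiple of this one, so in an irredundant
  relation all the \<open>b\<^sub>i\<close> occur on one side, all the \<open>a\<^sub>j\<close> on the other, and the side of
  the \<open>b\<^sub>i\<close> is shorter because \<open>2n < (2n + 1)m\<close>. No generator is a sum of others since both
  coefficients exceed 1, and none is prime since removing one summand from a side of the relation
  leaves an element with a unique factorization.
\<close>

section \<open>Monoids whose only unit is the identity\<close>

context comm_monoid_cancel
begin

lemma reduced_class_trivial:
  assumes "Units G = {\<one>}" and "a \<in> carrier G"
  shows "reduced_class G a = {a}"
  using assms by (simp add: reduced_class_def r_coset_def)

text \<open>Without nontrivial units the quotient map sends \<open>a\<close> to \<open>{a}\<close>,
  so it is an isomorphism and atoms can be found in the monoid itself.\<close>

lemma atoms_reduced_trivial: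
  assumes U: "Units G = {\<one>}"
  shows "atoms (reduced G) = (\<lambda>a. {a}) ` atoms G"
proof -
  have car: "carrier (reduced G) = (\<lambda>a. {a}) ` carrier G"
    by (auto simp: carrier_reduced reduced_class_trivial[OF U])
  have mult: "{a} \<otimes>\<^bsub>reduced G\<^esub> {b} = {a \<otimes> b}" if "a \<in> carrier G" "b \<in> carrier G" for a b
    using mult_reduced[OF that] that by (simp add: reduced_class_trivial[OF U])
  have one: "\<one>\<^bsub>reduced G\<^esub> = {\<one>}"
    by (simp add: one_reduced reduced_class_trivial[OF U])
  have unit: "a = \<one>" if "a \<in> carrier G" "b \<in> carrier G" "a \<otimes> b = \<one>" "b \<otimes> a = \<one>" for a b
    using that U unfolding Units_def by blast
  have "Units (reduced G) = {{\<one>}}"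
  proof
    show "Units (reduced G) \<subseteq> {{\<one>}}"
      unfolding Units_def by (auto simp: car one mult dest: unit)
    show "{{\<one>}} \<subseteq> Units (reduced G)"
      unfolding Units_def by (auto simp: car one mult)
  qed
  then show ?thesis
    by (auto simp: atoms_def car mult U)
qed

end

section \<open>The monoid with a single relation\<close>

locale balanced_relation =
  fixes m n :: nat
  assumes m_pos: "m > 0" and n_pos: "n > 0"
begin

text \<open>Exponent vector of the short side minus that of the long side of the relation. Indices
  below \<open>n\<close> stand for the \<open>b\<^sub>i\<close>, those from \<open>n\<close> to
  \<open>n + m - 1\<close> for the \<open>a\<^sub>j\<close>.\<close>

definition v :: "nat \<Rightarrow> int" where
  "v i = (if i < n then 2 else - (2 * int n + 1))"

definition generator_words :: "nat multiset set" where
  "generator_words = {X. set_mset X \<subseteq> {..<n + m}}"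

text \<open>
  Since \<^term>\<open>v 0 = 2\<close>, the linear extension of this map vanishes exactly on the vectors
  proportional to \<^term>\<open>v\<close>, which realises the quotient by the relation inside functions.
\<close>

definition cls :: "nat multiset \<Rightarrow> nat \<Rightarrow> int" where
  "cls X = (\<lambda>i. if i < n + m then v i * int (count X 0) - 2 * int (count X i) else 0)"

definition relation_monoid :: "(nat \<Rightarrow> int) monoid" where
  "relation_monoid = \<lparr>carrier = cls ` generator_words, mult = (\<lambda>f g i. f i + g i), one = (\<lambda>i. 0)\<rparr>"

abbreviation "\<M> \<equiv> relation_monoid"

lemma words_simps [simp]:
  "{#} \<in> generator_words"
  "X + Y \<in> generator_words \<longleftrightarrow> X \<in> generator_words \<and> Y \<in> generator_words"
  "add_mset i X \<in> generator_words \<longleftrightarrow> i < n + m \<and> X \<in> generator_words"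
  by (auto simp: generator_words_def)

lemma count_word: "X \<in> generator_words \<Longrightarrow> i \<ge> n + m \<Longrightarrow> count X i = 0"
  by (auto simp: generator_words_def count_eq_zero_iff)

lemma word_eqI:
  assumes "X \<in> generator_words" "Y \<in> generator_words" "\<And>i. i < n + m \<Longrightarrow> count X i = count Y i"
  shows "X = Y"
  using assms count_word by (metis multiset_eqI not_less)

lemma size_word: "X \<in> generator_words \<Longrightarrow> size X = (\<Sum>i<n + m. count X i)"
  unfolding size_multiset_overloaded_eq
  by (rule sum.mono_neutral_left) (auto simp: generator_words_def not_in_iff)

text \<open>Equal classes make the exponent difference \<open>d\<close> a rational multiple of
  \<open>v\<close>; the factor \<open>d 0 / 2\<close> is an integer because 2 and
  \<open>2 * n + 1\<close> are coprime.\<close>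

lemma cls_eqE:
  assumes eq: "cls X = cls Y"
  obtains k where "\<And>i. i < n + m \<Longrightarrow> int (count X i) - int (count Y i) = k * v i"
proof -
  define d where "d i = int (count X i) - int (count Y i)" for i
  have d: "v i * d 0 = 2 * d i" if "i < n + m" for i
    using fun_cong[OF eq, of i] that by (simp add: cls_def d_def algebra_simps)
  \<comment> \<open>Index \<open>n\<close> is the first \<open>a\<^sub>j\<close>, present as
    \<open>m > 0\<close>; its odd coefficient forces \<open>d 0\<close> to be even.\<close>
  have "- (2 * int n + 1) * d 0 = 2 * d n"
    using d[of n] m_pos by (simp add: v_def)
  then have "even ((2 * int n + 1) * d 0)"
    by (metis dvd_triv_left even_minus mult_minus_left)
  then have "even (d 0)" by simp
  then obtain k where k: "d 0 = 2 * k" by (elim evenE)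
  have "d i = k * v i" if "i < n + m" for i
    using d[OF that] by (simp add: k mult.commute)
  then show ?thesis by (intro that[of k]) (simp add: d_def)
qed

lemma cls_eqI:
  assumes "\<And>i. i < n + m \<Longrightarrow> int (count X i) - int (count Y i) = k * v i"
  shows "cls X = cls Y"
proof
  fix i
  show "cls X i = cls Y i"
  proof (cases "i < n + m")
    case True
    have "int (count X 0) - int (count Y 0) = k * 2"
      using assms[of 0] n_pos by (simp add: v_def)
    then have "int (count X 0) = int (count Y 0) + k * 2" by simp
    moreover have "int (count X i) = int (count Y i) + k * v i"
      using assms[OF True] by simp
    ultimately show ?thesis
      by (simp add: cls_def algebra_simps)
  qed (simp add: cls_def)
qed

text \<open>The bounds on \<open>Y\<close> keep both sides of the defining relation from being contained in it.\<close>

lemma cls_rigid: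
  assumes eq: "cls X = cls Y" and XY: "X \<in> generator_words" "Y \<in> generator_words"
    and Y0: "count Y 0 < 2" and Yn: "count Y n < 2 * n + 1"
  shows "X = Y"
proof -
  obtain k where k: "\<And>i. i < n + m \<Longrightarrow> int (count X i) - int (count Y i) = k * v i"
    using cls_eqE[OF eq] by blast
  have k0: "int (count X 0) - int (count Y 0) = k * 2"
    using k[of 0] n_pos by (simp add: v_def)
  have kn: "k * (2 * int n + 1) = int (count Y n) - int (count X n)"
    using k[of n] m_pos by (simp add: v_def algebra_simps)
  \<comment> \<open>A factor \<open>k \<ge> 1\<close> would need at least \<open>2 * n + 1\<close>
    copies of \<open>n\<close> in \<open>Y\<close>, and \<open>k \<le> - 1\<close> at least two
    copies of 0.\<close>
  have "k * (2 * int n + 1) < 1 * (2 * int n + 1)"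
    unfolding kn using Yn by simp
  then have "k < 1"
    by (rule mult_right_less_imp_less) simp
  moreover have "k > - 1" using k0 Y0 by linarith
  ultimately have "k = 0" by linarith
  with k XY show ?thesis by (auto intro: word_eqI)
qed

lemma monoid_simps [simp]:
  "\<one>\<^bsub>\<M>\<^esub> = cls {#}"
  "cls X \<otimes>\<^bsub>\<M>\<^esub> cls Y = cls (X + Y)"
  "X \<in> generator_words \<Longrightarrow> cls X \<in> carrier \<M>"
  by (auto simp: relation_monoid_def cls_def algebra_simps)

lemma carrierE:
  assumes "f \<in> carrier \<M>"
  obtains X where "X \<in> generator_words" "f = cls X"
  using assms by (auto simp: relation_monoid_def)

sublocale comm_monoid_cancel \<M>
proof (rule comm_monoid_cancelI)
  show "comm_monoid \<M>"
    by (rule comm_monoidI) (auto elim!: carrierE simp: ac_simps)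
  \<comment> \<open>Cancellation is inherited from the additive group of integer-valued
    functions.\<close>
  show "a = b" if "a \<otimes>\<^bsub>\<M>\<^esub> c = b \<otimes>\<^bsub>\<M>\<^esub> c" for a b c
    using that by (simp add: relation_monoid_def fun_eq_iff)
qed

section \<open>Units, atoms and atomicity\<close>

lemma cls_eq_empty: "X \<in> generator_words \<Longrightarrow> cls X = cls {#} \<longleftrightarrow> X = {#}"
  using cls_rigid[of X "{#}"] by auto

text \<open>Both coefficients 2 and \<open>2 * n + 1\<close> exceed 1, the latter by
  \<open>n > 0\<close>, so a one-letter word is rigid. This makes generators indecomposable and
  pairwise distinct.\<close>

lemma cls_eq_single:
  assumes "X \<in> generator_words" "i < n + m"
  shows "cls X = cls {#i#} \<longleftrightarrow> X = {#i#}"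
  using cls_rigid[of X "{#i#}"] assms n_pos by auto

lemma Units_relation_monoid: "Units \<M> = {\<one>\<^bsub>\<M>\<^esub>}"
proof
  show "Units \<M> \<subseteq> {\<one>\<^bsub>\<M>\<^esub>}"
    unfolding Units_def by (auto elim!: carrierE simp: cls_eq_empty)
qed (simp del: monoid_simps)

lemma atoms_relation_monoid: "atoms \<M> = (\<lambda>i. cls {#i#}) ` {..<n + m}"
proof (intro equalityI subsetI)
  fix a assume a: "a \<in> atoms \<M>"
  then obtain X where X: "X \<in> generator_words" "a = cls X"
    by (auto simp: atoms_def elim: carrierE)
  with a have "X \<noteq> {#}"
    by (auto simp: atoms_def Units_relation_monoid simp del: Units_one_closed)
  then obtain i Y where Y: "X = add_mset i Y" by (meson multiset_cases)
  with X have iY: "i < n + m" "Y \<in> generator_words" by auto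
  have "a = cls {#i#} \<otimes>\<^bsub>\<M>\<^esub> cls Y" by (simp add: X Y)
  with a iY have "cls {#i#} \<in> Units \<M> \<or> cls Y \<in> Units \<M>"
    by (simp add: atoms_def)
  with iY have "Y = {#}"
    by (auto simp: Units_relation_monoid cls_eq_empty)
  with X Y iY show "a \<in> (\<lambda>i. cls {#i#}) ` {..<n + m}" by auto
next
  fix a assume "a \<in> (\<lambda>i. cls {#i#}) ` {..<n + m}"
  then obtain i where i: "i < n + m" "a = cls {#i#}" by auto
  have "X = {#} \<or> Y = {#}"
    if "X \<in> generator_words" "Y \<in> generator_words" "cls {#i#} = cls (X + Y)" for X Y
  proof -
    have "X + Y = {#i#}" using that i cls_eq_single[of "X + Y" i] by simp
    then show ?thesis by (auto simp: union_is_single)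
  qed
  with i show "a \<in> atoms \<M>"
    by (fastforce simp: atoms_def Units_relation_monoid cls_eq_empty elim!: carrierE)
qed

lemma atomic_relation_monoid: "atomic_monoid \<M>"
proof -
  have fold: "foldr (\<otimes>\<^bsub>\<M>\<^esub>) (map (\<lambda>i. cls {#i#}) xs) \<one>\<^bsub>\<M>\<^esub> = cls (mset xs)" for xs
    by (induction xs) simp_all
  have "\<exists>as. set as \<subseteq> atoms \<M> \<and> x = foldr (\<otimes>\<^bsub>\<M>\<^esub>) as \<one>\<^bsub>\<M>\<^esub>" if "x \<in> carrier \<M>" for x
  proof -
    obtain X where X: "X \<in> generator_words" "x = cls X" using \<open>x \<in> carrier \<M>\<close> by (rule carrierE)
    obtain xs where "mset xs = X" using ex_mset by blast
    with X show ?thesis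
      using fold[of xs]
      by (intro exI[of _ "map (\<lambda>i. cls {#i#}) xs"])
        (auto simp: atoms_relation_monoid generator_words_def)
  qed
  then show ?thesis
    unfolding atomic_monoid_def using comm_monoid_cancel_axioms by blast
qed

section \<open>Factorizations\<close>

text \<open>Identifies words in the indices with formal sums of atoms of the reduced monoid, whose
  classes are singletons.\<close>

definition word_factorization :: "nat multiset \<Rightarrow> (nat \<Rightarrow> int) set multiset" where
  "word_factorization X = image_mset (\<lambda>i. {cls {#i#}}) X"

lemma atoms_reduced_relation_monoid: "atoms (reduced \<M>) = (\<lambda>i. {cls {#i#}}) ` {..<n + m}"
  by (simp add: atoms_reduced_trivial[OF Units_relation_monoid] atoms_relation_monoid image_image)

lemma factorizations_relation_monoid: "factorizations \<M> = word_factorization ` generator_words"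
proof (intro equalityI subsetI)
  fix z assume "z \<in> factorizations \<M>"
  then have "set_mset z \<subseteq> (\<lambda>i. {cls {#i#}}) ` {..<n + m}"
    by (simp add: factorizations_def atoms_reduced_relation_monoid)
  then show "z \<in> word_factorization ` generator_words"
  proof (induction z)
    case empty
    show ?case by (auto simp: word_factorization_def intro!: image_eqI[of _ _ "{#}"])
  next
    case (add a z)
    then obtain X where "X \<in> generator_words" "z = word_factorization X" by auto
    moreover from add.prems obtain i where "i < n + m" "a = {cls {#i#}}" by auto
    ultimately show ?case
      by (auto simp: word_factorization_def intro!: image_eqI[of _ _ "add_mset i X"])
  qed
next
  fix z assume "z \<in> word_factorization ` generator_words"
  then show "z \<in> factorizations \<M>"
    unfolding factorizations_def atoms_reduced_relation_monoid word_factorization_def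
      generator_words_def by fastforce
qed

text \<open>Under this identification the factorization homomorphism becomes \<open>cls\<close>,
  since both are additive and agree on single letters.\<close>

lemma factorization_hom_word:
  "X \<in> generator_words \<Longrightarrow> factorization_hom \<M> (word_factorization X) = {cls X}"
proof (induction X)
  case empty
  show ?case
    using factorization_hom_empty one_reduced
    by (simp add: word_factorization_def reduced_class_trivial[OF Units_relation_monoid])
next
  case (add i X)
  then have iX: "i < n + m" "X \<in> generator_words" by auto
  have single: "word_factorization {#i#} = {#{cls {#i#}}#}"
    by (simp add: word_factorization_def)
  have "word_factorization (add_mset i X) = word_factorization {#i#} + word_factorization X"
    by (simp add: word_factorization_def)
  also have "factorization_hom \<M> \<dots> =
      factorization_hom \<M> (word_factorization {#i#}) \<otimes>\<^bsub>reduced \<M>\<^esub> {cls X}"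
    using iX add.IH
    by (subst factorization_hom_union) (auto simp: factorizations_relation_monoid)
  also have "factorization_hom \<M> (word_factorization {#i#}) = {cls {#i#}}"
    unfolding single using iX
    by (intro factorization_hom_single) (auto simp: atoms_reduced_relation_monoid)
  also have "{cls {#i#}} \<otimes>\<^bsub>reduced \<M>\<^esub> {cls X} = {cls (add_mset i X)}"
    using mult_reduced[of "cls {#i#}" "cls X"] iX
    by (simp add: reduced_class_trivial[OF Units_relation_monoid])
  finally show ?case .
qed

lemma factorization_relation_words:
  assumes "X \<in> generator_words" "Y \<in> generator_words"
  shows "factorization_relation \<M> (word_factorization X) (word_factorization Y) \<longleftrightarrow> cls X = cls Y"
  using assms by (auto simp: factorization_relation_def factorizations_relation_monoid
      factorization_hom_word)

lemma cls_single_inject: "i < n + m \<Longrightarrow> j < n + m \<Longrightarrow> cls {#i#} = cls {#j#} \<longleftrightarrow> i = j"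
  by (simp add: cls_eq_single)

lemma in_word_factorization:
  assumes "X \<in> generator_words" "i < n + m"
  shows "{cls {#i#}} \<in># word_factorization X \<longleftrightarrow> i \<in># X"
  using assms cls_single_inject by (fastforce simp: word_factorization_def generator_words_def)

lemma irredundant_words:
  assumes "X \<in> generator_words" "Y \<in> generator_words"
  shows "irredundant (word_factorization X) (word_factorization Y) \<longleftrightarrow> irredundant X Y"
proof -
  have "set_mset (word_factorization X) \<inter> set_mset (word_factorization Y)
      = (\<lambda>i. {cls {#i#}}) ` (set_mset X \<inter> set_mset Y)"
    unfolding word_factorization_def set_image_mset
    by (rule inj_on_image_Int[symmetric, of _ "{..<n + m}"])
      (use assms in \<open>auto simp: inj_on_def cls_single_inject generator_words_def\<close>)
  then show ?thesis by (simp add: irredundant_def)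
qed

text \<open>Moves the condition on lengths from formal sums to words; the parameter \<open>P\<close>
  lets one transfer serve both the purely long and the purely short case.\<close>

lemma irredundant_relation_iff:
  assumes i: "i < n + m"
  shows "(\<forall>z\<^sub>1 z\<^sub>2. factorization_relation \<M> z\<^sub>1 z\<^sub>2 \<and> irredundant z\<^sub>1 z\<^sub>2
      \<and> reduced_class \<M> (cls {#i#}) \<in># z\<^sub>1 \<longrightarrow> P (size z\<^sub>1) (size z\<^sub>2)) \<longleftrightarrow>
    (\<forall>X\<in>generator_words. \<forall>Y\<in>generator_words.
      cls X = cls Y \<and> irredundant X Y \<and> i \<in># X \<longrightarrow> P (size X) (size Y))" (is "?L \<longleftrightarrow> ?R")
proof -
  have cl: "reduced_class \<M> (cls {#i#}) = {cls {#i#}}"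
    using i by (simp add: reduced_class_trivial[OF Units_relation_monoid])
  have sz: "size (word_factorization X) = size X" for X
    by (simp add: word_factorization_def)
  have "?L \<longleftrightarrow> (\<forall>z\<^sub>1\<in>factorizations \<M>. \<forall>z\<^sub>2\<in>factorizations \<M>.
      factorization_relation \<M> z\<^sub>1 z\<^sub>2 \<and> irredundant z\<^sub>1 z\<^sub>2 \<and> {cls {#i#}} \<in># z\<^sub>1
      \<longrightarrow> P (size z\<^sub>1) (size z\<^sub>2))"
    unfolding cl by (auto simp: factorization_relation_def)
  also have "\<dots> \<longleftrightarrow> ?R"
    unfolding factorizations_relation_monoid
    using i by (simp add: factorization_relation_words irredundant_words in_word_factorization sz)
  finally show ?thesis .
qed

section \<open>The defining relation\<close>

definition short_side :: "nat multiset" where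
  "short_side = (\<Sum>i\<in>{..<n}. replicate_mset 2 i)"

definition long_side :: "nat multiset" where
  "long_side = (\<Sum>i\<in>{n..<n + m}. replicate_mset (2 * n + 1) i)"

lemma count_sum_replicate:
  "finite A \<Longrightarrow> count (\<Sum>i\<in>A. replicate_mset c i) j = (if j \<in> A then c else 0)"
  by (simp add: count_sum sum.delta')

lemma count_short_side: "count short_side i = (if i < n then 2 else 0)"
  by (simp add: short_side_def count_sum_replicate)

lemma count_long_side: "count long_side i = (if n \<le> i \<and> i < n + m then 2 * n + 1 else 0)"
  by (simp add: long_side_def count_sum_replicate del: replicate_mset_Suc)

lemma sides_words: "short_side \<in> generator_words" "long_side \<in> generator_words"
  by (auto simp: generator_words_def count_short_side count_long_side
      simp flip: count_greater_zero_iff split: if_splits)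

lemma cls_sides: "cls short_side = cls long_side"
  by (rule cls_eqI[where k = 1]) (auto simp: count_short_side count_long_side v_def)

lemma irredundant_sides: "irredundant short_side long_side" "irredundant long_side short_side"
  by (auto simp: irredundant_def count_short_side count_long_side
      simp flip: count_greater_zero_iff split: if_splits)

text \<open>Generator \<open>i\<close> divides the product of the classes of
  \<open>Y - {#c#}\<close> and \<open>{#c#}\<close>. Both words are rigid and avoid
  \<open>i\<close>, so it divides neither factor.\<close>

lemma not_prime_generator_aux:
  assumes XY: "X \<in> generator_words" "Y \<in> generator_words" "cls X = cls Y"
    and i: "i \<in># X" "i \<notin># Y" and c: "c \<in># Y"
    and small: "count (Y - {#c#}) 0 < 2" "count (Y - {#c#}) n < 2 * n + 1"
  shows "\<not> prime \<M> (cls {#i#})"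
proof
  assume prime: "prime \<M> (cls {#i#})"
  obtain X' where X': "X = add_mset i X'" using i by (metis insert_DiffM)
  define Y' where "Y' = Y - {#c#}"
  have Y': "Y = add_mset c Y'" using c by (simp add: Y'_def)
  have words: "X' \<in> generator_words" "Y' \<in> generator_words" "i < n + m" "c < n + m"
    using XY by (auto simp: X' Y')
  have "cls Y' \<otimes>\<^bsub>\<M>\<^esub> cls {#c#} = cls {#i#} \<otimes>\<^bsub>\<M>\<^esub> cls X'"
    using XY by (simp add: X' Y')
  then have "cls {#i#} divides\<^bsub>\<M>\<^esub> (cls Y' \<otimes>\<^bsub>\<M>\<^esub> cls {#c#})"
    using words unfolding factor_def by (intro bexI[of _ "cls X'"]) auto
  then have dvd_or: "cls {#i#} divides\<^bsub>\<M>\<^esub> cls Y' \<or> cls {#i#} divides\<^bsub>\<M>\<^esub> cls {#c#}"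
    using prime words by (intro prime_divides) auto
  \<comment> \<open>A rigid word is the only word of its element, so it contains every generator
    dividing that element.\<close>
  have dvd_imp: "i \<in># Z" if dvd: "cls {#i#} divides\<^bsub>\<M>\<^esub> cls Z"
    and Z: "Z \<in> generator_words" "count Z 0 < 2" "count Z n < 2 * n + 1" for Z
  proof -
    obtain w where w: "w \<in> carrier \<M>" "cls Z = cls {#i#} \<otimes>\<^bsub>\<M>\<^esub> w"
      using dvd by (auto simp: factor_def)
    from w(1) obtain W where "W \<in> generator_words" "w = cls W" by (rule carrierE)
    with w have W: "W \<in> generator_words" "cls (add_mset i W) = cls Z" by simp_all
    then have "add_mset i W = Z"
      using Z words by (intro cls_rigid) auto
    then show ?thesis by auto
  qed
  with dvd_or have "i \<in># Y' \<or> i \<in># {#c#}"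
    using dvd_imp[of Y'] dvd_imp[of "{#c#}"] words small n_pos
    by (auto simp: Y'_def split: if_splits)
  with i Y' show False by auto
qed

lemma not_prime_generator:
  assumes "i < n + m"
  shows "\<not> prime \<M> (cls {#i#})"
proof (cases "i < n")
  case True
  \<comment> \<open>Removing one \<open>n\<close> from the long side leaves \<open>2 * n\<close>
    copies of \<open>n\<close> and no 0, just within the bounds for rigidity.\<close>
  show ?thesis
    by (rule not_prime_generator_aux[of short_side long_side _ n])
      (use True m_pos n_pos sides_words cls_sides in
        \<open>auto simp: count_short_side count_long_side simp flip: count_greater_zero_iff\<close>)
next
  case False
  \<comment> \<open>Removing one 0 from the short side leaves a single 0 and no
    \<open>n\<close>.\<close>
  show ?thesis
    by (rule not_prime_generator_aux[of long_side short_side _ 0])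
      (use False assms m_pos n_pos sides_words cls_sides in
        \<open>auto simp: count_short_side count_long_side simp flip: count_greater_zero_iff\<close>)
qed

text \<open>The sum is the length of the short side minus that of the long side; the coefficient
  \<open>2 * n + 1\<close> keeps it negative for every \<open>m > 0\<close>.\<close>

lemma sum_v: "(\<Sum>i<n + m. v i) < 0"
proof -
  have "(\<Sum>i<n + m. v i) = (\<Sum>i<n. v i) + (\<Sum>i\<in>{n..<n + m}. v i)"
    by (metis le_add1 lessThan_atLeast0 le0 sum.atLeastLessThan_concat)
  also have "\<dots> = 2 * int n - (2 * int n + 1) * int m"
    by (simp add: v_def algebra_simps)
  also have "\<dots> < 0"
  proof -
    have "(2 * int n + 1) * 1 \<le> (2 * int n + 1) * int m"
      by (rule mult_left_mono) (use m_pos in auto)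
    then show ?thesis by (simp add: algebra_simps)
  qed
  finally show ?thesis .
qed

text \<open>The length difference is \<open>k\<close> times the negative sum of \<open>v\<close>,
  and \<open>k\<close> has the sign of \<open>v i\<close>, so the kind of \<open>i\<close> decides
  which side is longer.\<close>

lemma size_irredundant:
  assumes XY: "X \<in> generator_words" "Y \<in> generator_words" and eq: "cls X = cls Y"
    and irr: "irredundant X Y" and i: "i \<in># X"
  shows "if i < n then size X < size Y else size X > size Y"
proof -
  obtain k where k: "\<And>i. i < n + m \<Longrightarrow> int (count X i) - int (count Y i) = k * v i"
    using cls_eqE[OF eq] by blast
  have "int (size X) - int (size Y) = (\<Sum>i<n + m. int (count X i) - int (count Y i))"
    by (simp add: size_word XY sum_subtractf)
  also have "\<dots> = k * (\<Sum>i<n + m. v i)"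
    by (simp add: k sum_distrib_left)
  finally have sz: "int (size X) - int (size Y) = k * (\<Sum>i<n + m. v i)" .
  \<comment> \<open>Irredundancy keeps \<open>i\<close> out of \<open>Y\<close>, so
    \<open>k * v i\<close> is the positive number of copies of \<open>i\<close> in
    \<open>X\<close>.\<close>
  have "int (count Y i) = 0" "int (count X i) > 0"
    using irr i by (auto simp: irredundant_def count_eq_zero_iff)
  moreover have "i < n + m" using XY i by (auto simp: generator_words_def)
  ultimately have kv: "k * v i > 0"
    using k[of i] by linarith
  show ?thesis
  proof (cases "i < n")
    case True
    then have "k > 0" using kv by (simp add: v_def)
    then have "k * (\<Sum>i<n + m. v i) < 0" using sum_v by (simp add: mult_pos_neg)
    with True sz show ?thesis by simp
  next
    case False
    then have "k < 0" using kv by (auto simp: v_def zero_less_mult_iff)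
    then have "k * (\<Sum>i<n + m. v i) > 0" using sum_v by (simp add: mult_neg_neg)
    with False sz show ?thesis by simp
  qed
qed

text \<open>Rules out vacuous truth: one relation through \<open>i\<close> is what refutes the wrong
  kind for that generator.\<close>

lemma irredundant_relation_exists:
  assumes "i < n + m"
  obtains X Y where "X \<in> generator_words" "Y \<in> generator_words" "cls X = cls Y" "irredundant X Y"
    "i \<in># X"
proof (cases "i < n")
  case True
  then have "i \<in># short_side" by (simp add: count_short_side flip: count_greater_zero_iff)
  with that[of short_side long_side] show thesis
    by (simp add: sides_words cls_sides irredundant_sides)
next
  case False
  then have "i \<in># long_side" using assms
    by (simp add: count_long_side flip: count_greater_zero_iff)
  with that[of long_side short_side] show thesis
    by (simp add: sides_words cls_sides irredundant_sides)
qed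

lemma purely_short_generator:
  assumes i: "i < n + m"
  shows "purely_short \<M> (cls {#i#}) \<longleftrightarrow> i < n"
proof -
  have "purely_short \<M> (cls {#i#}) \<longleftrightarrow> (\<forall>X\<in>generator_words. \<forall>Y\<in>generator_words.
      cls X = cls Y \<and> irredundant X Y \<and> i \<in># X \<longrightarrow> size X < size Y)"
    unfolding purely_short_def irredundant_relation_iff[OF i, of "\<lambda>k l. k < l"]
    using i not_prime_generator by (auto simp: atoms_relation_monoid)
  also have "\<dots> \<longleftrightarrow> i < n"
    using irredundant_relation_exists[OF i] size_irredundant by (metis less_asym)
  finally show ?thesis .
qed

lemma purely_long_generator:
  assumes i: "i < n + m"
  shows "purely_long \<M> (cls {#i#}) \<longleftrightarrow> n \<le> i"
proof -
  have "purely_long \<M> (cls {#i#}) \<longleftrightarrow> (\<forall>X\<in>generator_words. \<forall>Y\<in>generator_words.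
      cls X = cls Y \<and> irredundant X Y \<and> i \<in># X \<longrightarrow> size X > size Y)"
    unfolding purely_long_def irredundant_relation_iff[OF i, of "\<lambda>k l. l < k"]
    using i not_prime_generator by (auto simp: atoms_relation_monoid)
  also have "\<dots> \<longleftrightarrow> n \<le> i"
    using irredundant_relation_exists[OF i] size_irredundant by (metis less_asym not_le)
  finally show ?thesis .
qed

section \<open>Counting the purely short and purely long atoms\<close>

lemma card_generator_classes:
  assumes "A \<subseteq> {..<n + m}"
  shows "card (reduced_class \<M> ` (\<lambda>i. cls {#i#}) ` A) = card A"
proof -
  have "reduced_class \<M> (cls {#i#}) = {cls {#i#}}" if "i \<in> A" for i
    using that assms by (subst reduced_class_trivial[OF Units_relation_monoid]) auto
  \<comment> \<open>Distinct generators are not associated, so passing to classes preserves their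
    number.\<close>
  then have "inj_on (\<lambda>i. reduced_class \<M> (cls {#i#})) A"
    using assms by (auto simp: inj_on_def cls_single_inject subset_iff)
  then show ?thesis by (simp add: image_image card_image)
qed

lemma card_purely_short: "card (purely_short_atoms \<M>) = n"
proof -
  have atom: "\<exists>i<n + m. a = cls {#i#}" if "purely_short \<M> a" for a
    using that by (auto simp: purely_short_def atoms_relation_monoid)
  have "{a. purely_short \<M> a} = (\<lambda>i. cls {#i#}) ` {..<n}"
  proof (intro equalityI subsetI)
    fix a assume "a \<in> {a. purely_short \<M> a}"
    with atom[of a] show "a \<in> (\<lambda>i. cls {#i#}) ` {..<n}"
      by (auto simp: purely_short_generator)
  qed (auto simp: purely_short_generator)
  then show ?thesis
    by (simp add: purely_short_atoms_def card_generator_classes)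
qed

lemma card_purely_long: "card (purely_long_atoms \<M>) = m"
proof -
  have atom: "\<exists>i<n + m. a = cls {#i#}" if "purely_long \<M> a" for a
    using that by (auto simp: purely_long_def atoms_relation_monoid)
  have "{a. purely_long \<M> a} = (\<lambda>i. cls {#i#}) ` {n..<n + m}"
  proof (intro equalityI subsetI)
    fix a assume "a \<in> {a. purely_long \<M> a}"
    with atom[of a] show "a \<in> (\<lambda>i. cls {#i#}) ` {n..<n + m}"
      by (auto simp: purely_long_generator)
  qed (auto simp: purely_long_generator)
  then show ?thesis
    using card_generator_classes[of "{n..<n + m}"]
    by (simp add: purely_long_atoms_def subset_iff)
qed

end

theorem corollary3p8:
  fixes m n :: nat
  assumes "m > 0" and "n > 0"
  shows "\<exists>M :: (nat \<Rightarrow> int) monoid. atomic_monoid M \<and>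
           card (purely_long_atoms M) = m \<and> card (purely_short_atoms M) = n"
proof -
  interpret balanced_relation m n using assms by unfold_locales
  show ?thesis
    using atomic_relation_monoid card_purely_long card_purely_short by blast
qed

end
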